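(* Let $\alpha>0$, $\lambda\in\mathbb{R}$, let $r\ge 0$ and $k\ge 1$ be integers, let $X_{\lambda,r}^{(1)},X_{\lambda,r}^{(2)},\dots,X_{\lambda,r}^{(k)}$ be independent and identically distributed $r$-truncated degenerate Poisson random variables with parameter $\alpha$, and let $X_{\lambda,r}=\sum_{i=1}^{k}X_{\lambda,r}^{(i)}$. Then, for every integer $n\ge 0$, $$P[X_{\lambda,r}=n]=\begin{cases}\dfrac{k!}{(e_{\lambda}(\alpha)-e_{\lambda,r}(\alpha))^{k}}\,\dfrac{\alpha^{n}}{n!}\,S_{2,\lambda}^{[r]}(n,kr+k), & \text{if } n\ge kr+k,\\[2mm] 0, & \text{otherwise.}\end{cases}$$
   Context: For $\lambda,x\in\mathbb{R}$ put $(x)_{0,\lambda}=1$ and $(x)_{n,\lambda}=x(x-\lambda)(x-2\lambda)\cdots(x-(n-1)\lambda)$ for $n\ge 1$. The degenerate exponential function is $e_{\lambda}(t)=(1+\lambda t)^{1/\lambda}=\sum_{j=0}^{\infty}(1)_{j,\lambda}\frac{t^j}{j!}$ (for $\lambda=0$, $e_0(t)=e^t$), and for an integer $r\ge 0$, $e_{\lambda,r}(t)=\sum_{j=0}^{r}(1)_{j,\lambda}\frac{t^j}{j!}$. The $r$-truncated degenerate Stirling numbers of the second kind $S_{2,\lambda}^{[r]}(n,kr+k)$, $n\ge kr+k$, are defined by the power series identity in $t$ $$\frac{1}{k!}\bigl(e_{\lambda}(t)-e_{\lambda,r}(t)\bigr)^{k}=\sum_{n=kr+k}^{\infty}S_{2,\lambda}^{[r]}(n,kr+k)\frac{t^{n}}{n!}.$$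 An $r$-truncated degenerate Poisson random variable with parameter $\alpha>0$ is a random variable $Y$ taking values in $\{r+1,r+2,\dots\}$ with probability mass function $$p_{\lambda,r}(j)=P\{Y=j\}=\frac{(1)_{j,\lambda}}{e_{\lambda}(\alpha)-e_{\lambda,r}(\alpha)}\,\frac{\alpha^j}{j!},\qquad j=r+1,r+2,\dots.$$ To say that $Y$ is such a random variable presupposes that $\lambda,\alpha,r$ are such that this is a probability mass function: the series $\sum_j (1)_{j,\lambda}\alpha^j/j!$ converges to $e_\lambda(\alpha)$, the denominator $e_{\lambda}(\alpha)-e_{\lambda,r}(\alpha)$ is nonzero, and all values $p_{\lambda,r}(j)$ are nonnegative (so that they sum to $1$). *)

theory Defs
  imports
    "HOL-Probability.Probability"
    "HOL-Computational_Algebra.Formal_Power_Series"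
begin

definition deg_falling :: "real \<Rightarrow> nat \<Rightarrow> real \<Rightarrow> real" where
  "deg_falling x n lam = (\<Prod>i<n. x - real i * lam)"

text \<open>
  For \<open>lam \<noteq> 0\<close> the value of \<open>powr\<close> at a base \<open>1 + lam * t \<le> 0\<close> is a junk value.  This does no harm
  below: for \<open>t > 0\<close> such a base forces \<open>lam < 0\<close> and \<open>t \<ge> 1 / \<bar>lam\<bar>\<close>, where the series of
  \<open>(1 + lam * t) powr (1 / lam)\<close> diverges, and that series is required to converge in
  \<open>trunc_deg_poisson_params\<close>.
\<close>

definition deg_exp :: "real \<Rightarrow> real \<Rightarrow> real" where
  "deg_exp lam t = (if lam = 0 then exp t else (1 + lam * t) powr (1 / lam))"

definition deg_exp_trunc :: "real \<Rightarrow> nat \<Rightarrow> real \<Rightarrow> real" where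
  "deg_exp_trunc lam r t = (\<Sum>j\<le>r. deg_falling 1 j lam * t ^ j / fact j)"

definition deg_exp_fps :: "real \<Rightarrow> real fps" where
  "deg_exp_fps lam = Abs_fps (\<lambda>j. deg_falling 1 j lam / fact j)"

definition deg_exp_trunc_fps :: "real \<Rightarrow> nat \<Rightarrow> real fps" where
  "deg_exp_trunc_fps lam r = Abs_fps (\<lambda>j. if j \<le> r then deg_falling 1 j lam / fact j else 0)"

text \<open>
  \<open>trunc_deg_stirling2 lam r n k\<close> stands for \<open>S(n, k * r + k)\<close>: the last argument is \<open>k\<close>, not the
  second index \<open>k * r + k\<close>.  It is read off as a coefficient of the defining generating function;
  that the generating function starts in degree \<open>k * r + k\<close>, so that the defining identity does
  hold, is \<open>trunc_deg_stirling2_gf\<close>.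
\<close>

definition trunc_deg_stirling2 :: "real \<Rightarrow> nat \<Rightarrow> nat \<Rightarrow> nat \<Rightarrow> real" where
  "trunc_deg_stirling2 lam r n k =
     fact n * fps_nth (fps_const (1 / fact k) * (deg_exp_fps lam - deg_exp_trunc_fps lam r) ^ k) n"

lemma trunc_deg_stirling2_gf:
  "fps_const (1 / fact k) * (deg_exp_fps lam - deg_exp_trunc_fps lam r) ^ k =
     Abs_fps (\<lambda>n. if k * r + k \<le> n then trunc_deg_stirling2 lam r n k / fact n else 0)"
proof (rule fps_ext)
  fix n
  define F where "F = deg_exp_fps lam - deg_exp_trunc_fps lam r"
  define G where "G = Abs_fps (\<lambda>j. fps_nth F (j + Suc r))"
  have "fps_nth F j = 0" if "j < Suc r" for j
    using that by (simp add: F_def deg_exp_fps_def deg_exp_trunc_fps_def)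
  then have "F = fps_X ^ Suc r * G"
    by (intro fps_ext) (simp add: fps_X_power_mult_nth G_def del: power_Suc)
  then have "F ^ k = fps_X ^ (k * r + k) * G ^ k"
    by (simp add: power_mult_distrib power_mult [symmetric] algebra_simps del: power_Suc)
  then have "fps_nth (F ^ k) n = 0" if "n < k * r + k"
    using that by (simp add: fps_X_power_mult_nth)
  then show "fps_nth (fps_const (1 / fact k) * (deg_exp_fps lam - deg_exp_trunc_fps lam r) ^ k) n =
      fps_nth (Abs_fps (\<lambda>n. if k * r + k \<le> n then trunc_deg_stirling2 lam r n k / fact n else 0)) n"
    by (auto simp: trunc_deg_stirling2_def F_def)
qed

definition trunc_deg_poisson_mass :: "real \<Rightarrow> nat \<Rightarrow> real \<Rightarrow> nat \<Rightarrow> real" where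
  "trunc_deg_poisson_mass lam r \<alpha> j =
     deg_falling 1 j lam / (deg_exp lam \<alpha> - deg_exp_trunc lam r \<alpha>) * (\<alpha> ^ j / fact j)"

definition trunc_deg_poisson_params :: "real \<Rightarrow> nat \<Rightarrow> real \<Rightarrow> bool" where
  "trunc_deg_poisson_params lam r \<alpha> \<longleftrightarrow>
     \<alpha> > 0 \<and>
     (\<lambda>j. deg_falling 1 j lam * \<alpha> ^ j / fact j) sums deg_exp lam \<alpha> \<and>
     deg_exp lam \<alpha> - deg_exp_trunc lam r \<alpha> \<noteq> 0 \<and>
     (\<forall>j\<ge>r + 1. trunc_deg_poisson_mass lam r \<alpha> j \<ge> 0)"

definition trunc_deg_poisson_rv ::
    "'a measure \<Rightarrow> real \<Rightarrow> nat \<Rightarrow> real \<Rightarrow> ('a \<Rightarrow> nat) \<Rightarrow> bool" where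
  "trunc_deg_poisson_rv M lam r \<alpha> Y \<longleftrightarrow>
     trunc_deg_poisson_params lam r \<alpha> \<and>
     Y \<in> M \<rightarrow>\<^sub>M count_space UNIV \<and>
     (AE \<omega> in M. Y \<omega> \<ge> r + 1) \<and>
     (\<forall>j\<ge>r + 1. \<P>(\<omega> in M. Y \<omega> = j) = trunc_deg_poisson_mass lam r \<alpha> j)"

end

theory Submission
  imports Defs
begin

text \<open>
  The generating function of the law of a truncated degenerate Poisson variable is
  \<open>(e(\<alpha> t) - e_r(\<alpha> t)) / (e(\<alpha>) - e_r(\<alpha>))\<close>, also in the degrees \<open>j \<le> r\<close>, where both sides vanish.
  Generating functions of independent variables multiply, so that of the sum is the \<open>k\<close>-th power,
  whose coefficients are Stirling numbers up to the factor \<open>\<alpha> ^ n\<close> coming from \<open>t \<mapsto> \<alpha> t\<close>.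
\<close>

lemma measurable_sum_nat_count_space:
  fixes f :: "'i \<Rightarrow> 'a \<Rightarrow> nat"
  assumes "\<And>i. i \<in> I \<Longrightarrow> f i \<in> N \<rightarrow>\<^sub>M count_space UNIV"
  shows "(\<lambda>x. \<Sum>i\<in>I. f i x) \<in> N \<rightarrow>\<^sub>M count_space UNIV"
  using assms by (induction I rule: infinite_finite_induct) simp_all

text \<open>The probability generating function, kept as a formal power series so that products and
  powers raise no question of convergence.\<close>

definition mass_fps :: "'a measure \<Rightarrow> ('a \<Rightarrow> nat) \<Rightarrow> real fps" where
  "mass_fps M Y = Abs_fps (\<lambda>j. \<P>(\<omega> in M. Y \<omega> = j))"

context prob_space
begin

text \<open>Both variables are measurable functions of restrictions of the family, to
  \<open>{i}\<close> and to \<open>I\<close>; these index sets are disjoint, so the restrictions are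
  independent.\<close>

lemma indep_var_sum_nat:
  fixes X :: "'i \<Rightarrow> 'a \<Rightarrow> nat"
  assumes "i \<notin> I" and indep: "indep_vars (\<lambda>_. count_space UNIV) X (insert i I)"
  shows "indep_var (count_space UNIV) (X i) (count_space UNIV) (\<lambda>\<omega>. \<Sum>i\<in>I. X i \<omega>)"
proof -
  have "(\<lambda>f. \<Sum>j\<in>I. f j) \<in> PiM I (\<lambda>_. count_space UNIV) \<rightarrow>\<^sub>M count_space (UNIV :: nat set)"
    by (rule measurable_sum_nat_count_space) (rule measurable_component_singleton)
  then have "indep_var
    (count_space UNIV) ((\<lambda>f. f i) \<circ> (\<lambda>\<omega>. restrict (\<lambda>i. X i \<omega>) {i}))
    (count_space UNIV) ((\<lambda>f. \<Sum>i\<in>I. f i) \<circ> (\<lambda>\<omega>. restrict (\<lambda>i. X i \<omega>) I))"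
    using assms(1) by (intro indep_var_compose[OF indep_var_restrict[OF indep]]) auto
  then show ?thesis
    by (simp add: comp_def)
qed

lemma mass_fps_add:
  assumes "indep_var (count_space UNIV) Y (count_space UNIV) Z"
  shows "mass_fps M (\<lambda>\<omega>. Y \<omega> + Z \<omega>) = mass_fps M Y * mass_fps M Z"
proof (rule fps_ext)
  fix n
  have rv [measurable]: "random_variable (count_space UNIV) Y" "random_variable (count_space UNIV) Z"
    using assms by (rule indep_var_rv1, rule indep_var_rv2)
  \<comment> \<open>Split by the value \<open>j\<close> of \<open>Y\<close>. Since \<open>j\<close>
    \<le> \<open>n\<close>, the natural subtraction \<open>n - j\<close> is exact. Independence
    turns the sum into a convolution, which is the \<open>n\<close>-th coefficient of the Cauchy
    product.\<close>
  have "prob {\<omega> \<in> space M. Y \<omega> + Z \<omega> = n} =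
      prob (\<Union>j\<in>{0..n}. {\<omega> \<in> space M. Y \<omega> = j \<and> Z \<omega> = n - j})"
    by (rule arg_cong[where f = prob]) auto
  also have "\<dots> = (\<Sum>j=0..n. prob {\<omega> \<in> space M. Y \<omega> = j \<and> Z \<omega> = n - j})"
    by (rule finite_measure_finite_Union) (auto simp: disjoint_family_on_def)
  also have "\<dots> = (\<Sum>j=0..n. prob {\<omega> \<in> space M. Y \<omega> = j} * prob {\<omega> \<in> space M. Z \<omega> = n - j})"
  proof (rule sum.cong)
    fix j
    show "prob {\<omega> \<in> space M. Y \<omega> = j \<and> Z \<omega> = n - j} =
        prob {\<omega> \<in> space M. Y \<omega> = j} * prob {\<omega> \<in> space M. Z \<omega> = n - j}"
      using indep_varD[OF assms, of "{j}" "{n - j}"]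
      by (simp add: vimage_def Int_def conj_commute)
  qed simp
  finally show "fps_nth (mass_fps M (\<lambda>\<omega>. Y \<omega> + Z \<omega>)) n = fps_nth (mass_fps M Y * mass_fps M Z) n"
    by (simp add: mass_fps_def fps_mult_nth)
qed

lemma mass_fps_sum:
  fixes X :: "'i \<Rightarrow> 'a \<Rightarrow> nat"
  assumes "finite I" "indep_vars (\<lambda>_. count_space UNIV) X I"
  shows "mass_fps M (\<lambda>\<omega>. \<Sum>i\<in>I. X i \<omega>) = (\<Prod>i\<in>I. mass_fps M (X i))"
  using assms
proof (induction I rule: finite_induct)
  case empty
  show ?case
    \<comment> \<open>The empty sum is the constant 0, whose whole mass 1 sits in degree 0; this is
      the series 1, the empty product.\<close>
    by (rule fps_ext) (simp add: mass_fps_def prob_space)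
next
  case (insert i I)
  have "indep_vars (\<lambda>_. count_space UNIV) X I"
    using insert.prems by (rule indep_vars_subset) auto
  with insert show ?case
    by (simp add: mass_fps_add indep_var_sum_nat)
qed

lemma mass_fps_trunc_deg_poisson:
  assumes "trunc_deg_poisson_rv M lam r \<alpha> Y"
  shows "mass_fps M Y = fps_const (1 / (deg_exp lam \<alpha> - deg_exp_trunc lam r \<alpha>)) *
    ((deg_exp_fps lam - deg_exp_trunc_fps lam r) oo (fps_const \<alpha> * fps_X))"
proof (rule fps_ext)
  fix j
  show "fps_nth (mass_fps M Y) j = fps_nth (fps_const (1 / (deg_exp lam \<alpha> - deg_exp_trunc lam r \<alpha>)) *
    ((deg_exp_fps lam - deg_exp_trunc_fps lam r) oo (fps_const \<alpha> * fps_X))) j"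
  proof (cases "j \<le> r")
    case True
    \<comment> \<open>The mass formula is given only above \<open>r\<close>, so here the left
      coefficient is 0 because the event is null; the right one is 0 by cancellation of the
      truncated series.\<close>
    have "AE \<omega> in M. Y \<omega> \<ge> r + 1"
      using assms by (simp add: trunc_deg_poisson_rv_def)
    then have "AE \<omega> in M. \<omega> \<notin> {\<omega> \<in> space M. Y \<omega> = j}"
      by eventually_elim (use True in auto)
    moreover have [measurable]: "random_variable (count_space UNIV) Y"
      using assms by (simp add: trunc_deg_poisson_rv_def)
    ultimately have "prob {\<omega> \<in> space M. Y \<omega> = j} = 0"
      by (subst prob_eq_0) simp_all
    with True show ?thesis
      by (simp add: mass_fps_def deg_exp_fps_def deg_exp_trunc_fps_def)
  next
    case False
    \<comment> \<open>Above \<open>r\<close> the truncated series contributes nothing, and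
      substituting \<alpha> t supplies the factor \<alpha>^j.\<close>
    with assms show ?thesis
      by (simp add: mass_fps_def trunc_deg_poisson_rv_def trunc_deg_poisson_mass_def
          deg_exp_fps_def deg_exp_trunc_fps_def)
  qed
qed

end

theorem theorem5:
  fixes M :: "'a measure" and X :: "nat \<Rightarrow> 'a \<Rightarrow> nat"
    and lam \<alpha> :: real and r k n :: nat
  assumes "prob_space M"
    and "\<alpha> > 0"
    and "k \<ge> 1"
    and "prob_space.indep_vars M (\<lambda>_. count_space UNIV) X {1..k}"
    and "\<And>i. i \<in> {1..k} \<Longrightarrow> trunc_deg_poisson_rv M lam r \<alpha> (X i)"
  shows "\<P>(\<omega> in M. (\<Sum>i=1..k. X i \<omega>) = n) =
    (if n \<ge> k * r + k
     then fact k / (deg_exp lam \<alpha> - deg_exp_trunc lam r \<alpha>) ^ k * (\<alpha> ^ n / fact n)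
            * trunc_deg_stirling2 lam r n k
     else 0)"
proof -
  interpret prob_space M by fact
  define D where "D = deg_exp lam \<alpha> - deg_exp_trunc lam r \<alpha>"
  define F where "F = deg_exp_fps lam - deg_exp_trunc_fps lam r"
  have "mass_fps M (\<lambda>\<omega>. \<Sum>i=1..k. X i \<omega>) = (\<Prod>i=1..k. mass_fps M (X i))"
    using assms(4) by (intro mass_fps_sum) auto
  also have "\<dots> = (\<Prod>i=1..k. fps_const (1 / D) * (F oo (fps_const \<alpha> * fps_X)))"
    unfolding D_def F_def by (intro prod.cong mass_fps_trunc_deg_poisson assms(5)) auto
  also have "\<dots> = (fps_const (1 / D) * (F oo (fps_const \<alpha> * fps_X))) ^ k"
    by simp
  \<comment> \<open>Substitution commutes with powers, so \<alpha> enters coefficient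
    \<open>n\<close> only as the factor \<alpha>^n.\<close>
  also have "\<dots> = fps_const (1 / D ^ k) * (F ^ k oo (fps_const \<alpha> * fps_X))"
    by (simp add: power_mult_distrib fps_compose_power power_one_over)
  finally have prob_eq: "\<P>(\<omega> in M. (\<Sum>i=1..k. X i \<omega>) = n) = 1 / D ^ k * (\<alpha> ^ n * fps_nth (F ^ k) n)"
    by (simp add: mass_fps_def fps_eq_iff)
  \<comment> \<open>Inserting \<open>fact k\<close> produces the series of
    \<open>trunc_deg_stirling2_gf\<close>, which also yields the zero case below degree
    \<open>k * r + k\<close>.\<close>
  have "fps_nth (F ^ k) n = fact k * fps_nth (fps_const (1 / fact k) * F ^ k) n"
    by simp
  also have "\<dots> = (if k * r + k \<le> n then fact k * trunc_deg_stirling2 lam r n k / fact n else 0)"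
    unfolding F_def trunc_deg_stirling2_gf by simp
  finally show ?thesis
    using prob_eq by (simp add: D_def mult_ac)
qed

end
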